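(* For fuzzy vectors $u,v,w\in\mathcal{F}^n$, the following statements are equivalent: (i) $u=v\oplus w$. (ii) $u_\alpha=v_\alpha+w_\alpha$ (Minkowski sum) for all $\alpha\in[0,1]$. (iii) $h_u=h_v+h_w$.
   Context: Let $n\geq 1$; $\langle-,-\rangle$ is the standard Euclidean inner product on $\mathbb{R}^n$, and $S^{n-1}$ is the unit sphere. A fuzzy vector (of dimension $n$) is a function $u:\mathbb{R}^n\to[0,1]$ such that: (V1) there is $t_0\in\mathbb{R}^n$ with $u(t_0)=1$; (V2) the closure of $\{t\in\mathbb{R}^n\mid u(t)>0\}$ is compact; (V3) $\min(u(s),u(t))\leq u(\lambda s+(1-\lambda)t)$ for all $s,t\in\mathbb{R}^n$ and $\lambda\in[0,1]$; (V4) $\{t\in\mathbb{R}^n\mid u(t)\geq\alpha\}$ is closed for all $\alpha\in[0,1]$. $\mathcal{F}^n$ is the set of all fuzzy vectors of dimension $n$. The level sets are $u_\alpha=\{t\mid u(t)\geq\alpha\}$ for $\alpha\in(0,1]$ and $u_0=\overline{\{t\mid u(t)>0\}}$. The support function of $u\in\mathcal{F}^n$ is $h_u:[0,1]\times S^{n-1}\to\mathbb{R}$, $h_u(\alpha,x):=\sup_{t\in u_\alpha}\langle t,x\rangle$. The sum of fuzzy vectors is given by Zadeh's extension principle: $(u\oplus v)(t):=\sup_{r+s=t}\min(u(r),v(s))$ for $t\in\mathbb{R}^n$. The Minkowski sum is $B+C=\{b+c\mid b\in B,c\in C\}$. *)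

theory Defs
  imports "HOL-Analysis.Analysis" "HOL-Library.Set_Algebras"
begin

definition fuzzy_vector :: "(real ^ 'n \<Rightarrow> real) \<Rightarrow> bool" where
  "fuzzy_vector u \<longleftrightarrow>
     (\<forall>t. u t \<in> {0..1}) \<and>
     (\<exists>t0. u t0 = 1) \<and>
     compact (closure {t. u t > 0}) \<and>
     (\<forall>s t. \<forall>c\<in>{0..1}. min (u s) (u t) \<le> u (c *\<^sub>R s + (1 - c) *\<^sub>R t)) \<and>
     (\<forall>\<alpha>\<in>{0..1}. closed {t. u t \<ge> \<alpha>})"

(* Only levels in {0..1} are meaningful; level 0 is the closed support. *)
definition level_set :: "(real ^ 'n \<Rightarrow> real) \<Rightarrow> real \<Rightarrow> (real ^ 'n) set" where
  "level_set u \<alpha> = (if \<alpha> = 0 then closure {t. u t > 0} else {t. u t \<ge> \<alpha>})"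

(* The support function has domain {0..1} \<times> sphere 0 1; here it is a total function, whose
   values outside that domain carry no meaning. For a fuzzy vector the level sets are nonempty
   and bounded, so the real supremum is the true one on the domain. *)
definition support_fun :: "(real ^ 'n \<Rightarrow> real) \<Rightarrow> real \<Rightarrow> real ^ 'n \<Rightarrow> real" where
  "support_fun u \<alpha> x = (SUP t\<in>level_set u \<alpha>. t \<bullet> x)"

(* Zadeh's extension principle; for [0,1]-valued u and v the supremum is over a nonempty set
   bounded by 1. *)
definition fuzzy_add ::
    "(real ^ 'n \<Rightarrow> real) \<Rightarrow> (real ^ 'n \<Rightarrow> real) \<Rightarrow> real ^ 'n \<Rightarrow> real" (infixl "\<oplus>\<^sub>F" 65) where
  "(u \<oplus>\<^sub>F v) t = Sup {min (u r) (v s) |r s. r + s = t}"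

end

theory Submission
  imports Defs
begin

text \<open>
  The bridge between the extension principle and the Minkowski sum is that the supremum defining
  \<open>(v \<oplus>\<^sub>F w) t\<close> is attained whenever it is positive: the decompositions \<open>r + s = t\<close> that come close
  to the supremum form a decreasing sequence of nonempty compact sets, and any common point attains
  it (\<open>fuzzy_add_ge_iff\<close>). Hence \<open>\<alpha> \<le> (v \<oplus>\<^sub>F w) t\<close> just says that \<open>t\<close> splits into a point of \<open>v\<^sub>\<alpha>\<close> and
  a point of \<open>w\<^sub>\<alpha>\<close>, for each \<open>\<alpha> > 0\<close>. Since a function into the unit interval is determined by its
  superlevel sets at positive levels, this already shows that (ii) implies (i), and the positive
  levels of the converse. At level 0 the sum of the open supports is the open support of the sum
  without any attainment, and passing to closures is harmless because a sum of compact sets is closed.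

  For (ii) and (iii) everything happens at one level. The level sets are nonempty, compact and convex,
  and so are their Minkowski sums. Suprema of linear functionals are additive over Minkowski sums,
  so (ii) implies (iii); conversely, by hyperplane separation such sets are determined by their
  support functions on the unit sphere (\<open>subset_if_support_le\<close>).
\<close>

section \<open>Compact convex sets and their support functions\<close>

lemma compact_set_plus:
  fixes S T :: "'a::real_normed_vector set"
  assumes "compact S" "compact T"
  shows "compact (S + T)"
proof -
  have "S + T = {x + y | x y. x \<in> S \<and> y \<in> T}"
    by (auto simp: set_plus_def)
  then show ?thesis
    using compact_sums[OF assms] by simp
qed

lemma closure_set_plus_compact:
  fixes S T :: "'a::real_normed_vector set"
  assumes "compact (closure S)" "compact (closure T)"
  shows "closure (S + T) = closure S + closure T"
proof
  have "S + T \<subseteq> closure S + closure T"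
    by (intro set_plus_mono2 closure_subset)
  then show "closure (S + T) \<subseteq> closure S + closure T"
    by (intro closure_minimal compact_imp_closed compact_set_plus assms)
qed (rule closure_sum)

lemma bdd_above_inner_image:
  fixes S :: "'a::real_inner set"
  assumes "compact S"
  shows "bdd_above ((\<lambda>t. t \<bullet> x) ` S)"
proof -
  have "compact ((\<lambda>t. t \<bullet> x) ` S)"
    by (intro compact_continuous_image continuous_intros assms)
  then show ?thesis
    by (intro bounded_imp_bdd_above compact_imp_bounded)
qed

lemma SUP_inner_set_plus:
  fixes S T :: "'a::real_inner set"
  assumes "compact S" "S \<noteq> {}" "compact T" "T \<noteq> {}"
  shows "(SUP t\<in>S + T. t \<bullet> x) = (SUP t\<in>S. t \<bullet> x) + (SUP t\<in>T. t \<bullet> x)"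
proof (rule antisym)
  show "(SUP t\<in>S + T. t \<bullet> x) \<le> (SUP t\<in>S. t \<bullet> x) + (SUP t\<in>T. t \<bullet> x)"
  proof (rule cSUP_least)
    show "S + T \<noteq> {}" using assms by (auto simp: set_plus_def)
  next
    fix t assume "t \<in> S + T"
    then obtain a b where t: "t = a + b" "a \<in> S" "b \<in> T"
      by (rule set_plus_elim)
    have "a \<bullet> x \<le> (SUP t\<in>S. t \<bullet> x)" "b \<bullet> x \<le> (SUP t\<in>T. t \<bullet> x)"
      using t assms by (auto intro: cSUP_upper bdd_above_inner_image)
    then show "t \<bullet> x \<le> (SUP t\<in>S. t \<bullet> x) + (SUP t\<in>T. t \<bullet> x)"
      by (simp add: t inner_add_left)
  qed
next
  have sum_le: "a \<bullet> x + b \<bullet> x \<le> (SUP t\<in>S + T. t \<bullet> x)" if "a \<in> S" "b \<in> T" for a b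
  proof -
    have "(a + b) \<bullet> x \<le> (SUP t\<in>S + T. t \<bullet> x)"
      using that by (intro cSUP_upper bdd_above_inner_image compact_set_plus assms set_plus_intro)
    then show ?thesis by (simp add: inner_add_left)
  qed
  have "(SUP t\<in>S. t \<bullet> x) \<le> (SUP t\<in>S + T. t \<bullet> x) - b \<bullet> x" if "b \<in> T" for b
    using sum_le[OF _ that] by (intro cSUP_least assms) (simp add: algebra_simps)
  then have "(SUP t\<in>T. t \<bullet> x) \<le> (SUP t\<in>S + T. t \<bullet> x) - (SUP t\<in>S. t \<bullet> x)"
    by (intro cSUP_least assms) (simp add: algebra_simps)
  then show "(SUP t\<in>S. t \<bullet> x) + (SUP t\<in>T. t \<bullet> x) \<le> (SUP t\<in>S + T. t \<bullet> x)"
    by simp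
qed

text \<open>
  A point of \<open>S\<close> outside \<open>T\<close> could be separated from \<open>T\<close> by a hyperplane; in the direction of its
  unit normal the support function of \<open>S\<close> would then exceed that of \<open>T\<close>.
\<close>

lemma subset_if_support_le:
  fixes S T :: "'a::euclidean_space set"
  assumes "compact S" "compact T" "convex T" "T \<noteq> {}"
    and le: "\<And>x. x \<in> sphere 0 1 \<Longrightarrow> (SUP t\<in>S. t \<bullet> x) \<le> (SUP t\<in>T. t \<bullet> x)"
  shows "S \<subseteq> T"
proof (rule subsetI, rule ccontr)
  fix z assume "z \<in> S" "z \<notin> T"
  obtain a b where ab: "a \<bullet> z < b" "\<And>t. t \<in> T \<Longrightarrow> b < a \<bullet> t"
    using separating_hyperplane_closed_point[of T z] assms \<open>z \<notin> T\<close> compact_imp_closed by metis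
  have "a \<noteq> 0"
    using ab \<open>T \<noteq> {}\<close> by fastforce
  \<comment> \<open>\<open>T\<close> lies on the side towards which \<open>a\<close> points, so the outer normal is \<open>- a\<close>.\<close>
  define x where "x = - (a /\<^sub>R norm a)"
  have x: "x \<in> sphere 0 1"
    using \<open>a \<noteq> 0\<close> by (simp add: x_def)
  have "(SUP t\<in>T. t \<bullet> x) \<le> - (b / norm a)"
  proof (rule cSUP_least[OF \<open>T \<noteq> {}\<close>])
    fix t assume "t \<in> T"
    then have "b / norm a \<le> (a \<bullet> t) / norm a"
      using ab(2) by (intro divide_right_mono) (auto intro: less_imp_le)
    then show "t \<bullet> x \<le> - (b / norm a)"
      by (simp add: x_def inner_commute divide_inverse mult.commute)
  qed
  also have "\<dots> < z \<bullet> x"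
  proof -
    have "(a \<bullet> z) / norm a < b / norm a"
      using ab(1) \<open>a \<noteq> 0\<close> by (intro divide_strict_right_mono) auto
    then show ?thesis
      by (simp add: x_def inner_commute divide_inverse mult.commute)
  qed
  also have "\<dots> \<le> (SUP t\<in>S. t \<bullet> x)"
    using \<open>z \<in> S\<close> \<open>compact S\<close> by (intro cSUP_upper bdd_above_inner_image)
  finally show False
    using le[OF x] by simp
qed

lemma set_eq_plus_iff_support:
  fixes S A B :: "'a::euclidean_space set"
  assumes S: "compact S" "convex S" "S \<noteq> {}"
    and A: "compact A" "convex A" "A \<noteq> {}"
    and B: "compact B" "convex B" "B \<noteq> {}"
  shows "S = A + B \<longleftrightarrow>
    (\<forall>x\<in>sphere 0 1. (SUP t\<in>S. t \<bullet> x) = (SUP t\<in>A. t \<bullet> x) + (SUP t\<in>B. t \<bullet> x))"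
proof -
  have AB: "compact (A + B)" "convex (A + B)" "A + B \<noteq> {}"
    using A B by (auto simp: compact_set_plus convex_set_plus)
  have "S = A + B \<longleftrightarrow> (\<forall>x\<in>sphere 0 1. (SUP t\<in>S. t \<bullet> x) = (SUP t\<in>A + B. t \<bullet> x))"
  proof
    assume eq: "\<forall>x\<in>sphere 0 1. (SUP t\<in>S. t \<bullet> x) = (SUP t\<in>A + B. t \<bullet> x)"
    show "S = A + B"
      using eq by (intro antisym subset_if_support_le S AB) (auto intro: eq_refl)
  qed simp
  then show ?thesis
    by (simp add: SUP_inner_set_plus A B)
qed

section \<open>Level sets of fuzzy vectors\<close>

lemma fuzzy_vector_range:
  assumes "fuzzy_vector u"
  shows "0 \<le> u t" "u t \<le> 1"
  using assms by (auto simp: fuzzy_vector_def)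

lemma convex_superlevel_strict:
  assumes "fuzzy_vector u"
  shows "convex {t. u t > \<beta>}"
proof (rule convexI)
  fix s t and a b :: real
  assume *: "s \<in> {t. u t > \<beta>}" "t \<in> {t. u t > \<beta>}" "0 \<le> a" "0 \<le> b" "a + b = 1"
  then have "min (u s) (u t) \<le> u (a *\<^sub>R s + (1 - a) *\<^sub>R t)"
    using assms by (simp add: fuzzy_vector_def)
  moreover have "1 - a = b" using * by simp
  ultimately show "a *\<^sub>R s + b *\<^sub>R t \<in> {t. u t > \<beta>}"
    using * by auto
qed

lemma convex_superlevel:
  assumes "fuzzy_vector u"
  shows "convex {t. u t \<ge> \<beta>}"
proof -
  \<comment> \<open>An intersection of convex sets is convex, so the strict case suffices.\<close>
  have "{t. u t \<ge> \<beta>} = (\<Inter>\<gamma>\<in>{..<\<beta>}. {t. u t > \<gamma>})"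
  proof (intro subset_antisym subsetI)
    fix t assume "t \<in> (\<Inter>\<gamma>\<in>{..<\<beta>}. {t. u t > \<gamma>})"
    then have "\<gamma> \<le> u t" if "\<gamma> < \<beta>" for \<gamma>
      using that by (simp add: less_imp_le)
    then show "t \<in> {t. u t \<ge> \<beta>}"
      by (simp add: dense_le)
  qed simp
  then show ?thesis
    by (simp add: convex_INT convex_superlevel_strict[OF assms])
qed

lemma compact_superlevel:
  assumes "fuzzy_vector u" "0 < \<beta>" "\<beta> \<le> 1"
  shows "compact {t. u t \<ge> \<beta>}"
proof -
  have "closed {t. u t \<ge> \<beta>}" "compact (closure {t. u t > 0})"
    using assms by (auto simp: fuzzy_vector_def)
  moreover have "{t. u t \<ge> \<beta>} \<subseteq> closure {t. u t > 0}"
    using \<open>0 < \<beta>\<close> closure_subset[of "{t. u t > 0}"] by auto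
  ultimately show ?thesis
    by (metis closed_Int_compact inf.absorb1)
qed

lemma level_set_compact_convex_nonempty:
  assumes "fuzzy_vector u" "\<alpha> \<in> {0..1}"
  shows "compact (level_set u \<alpha>)" "convex (level_set u \<alpha>)" "level_set u \<alpha> \<noteq> {}"
proof -
  obtain t0 where t0: "u t0 = 1"
    using assms by (auto simp: fuzzy_vector_def)
  have "compact (closure {t. u t > 0})"
    using assms by (simp add: fuzzy_vector_def)
  then show "compact (level_set u \<alpha>)"
    using assms compact_superlevel[of u \<alpha>] by (auto simp: level_set_def)
  show "convex (level_set u \<alpha>)"
    using assms by (auto simp: level_set_def convex_closure convex_superlevel_strict convex_superlevel)
  have "t0 \<in> {t. u t > 0}" using t0 by simp
  then have "t0 \<in> level_set u \<alpha>"
    using t0 assms closure_subset[of "{t. u t > 0}"] by (auto simp: level_set_def)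
  then show "level_set u \<alpha> \<noteq> {}" by blast
qed

section \<open>Superlevel sets of the extension-principle sum\<close>

lemma min_le_fuzzy_add:
  assumes "fuzzy_vector v"
  shows "min (v r) (w s) \<le> (v \<oplus>\<^sub>F w) (r + s)"
  unfolding fuzzy_add_def
proof (rule cSup_upper)
  show "min (v r) (w s) \<in> {min (v r') (w s') |r' s'. r' + s' = r + s}"
    by (rule CollectI, rule exI[of _ r], rule exI[of _ s]) simp
  have "min (v r') (w s') \<le> 1" for r' s'
    using fuzzy_vector_range(2)[OF assms, of r'] by (rule min.coboundedI1)
  then show "bdd_above {min (v r') (w s') |r' s'. r' + s' = r + s}"
    by (intro bdd_aboveI[of _ 1]) (elim CollectE exE conjE, simp only:)
qed

lemma less_fuzzy_addE:
  assumes "y < (v \<oplus>\<^sub>F w) t"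
  obtains r s where "r + s = t" "y < v r" "y < w s"
proof -
  let ?M = "{min (v r) (w s) |r s. r + s = t}"
  have "min (v t) (w 0) \<in> ?M"
    by (rule CollectI, rule exI[of _ t], rule exI[of _ 0]) simp
  then have "?M \<noteq> {}" by (metis empty_iff)
  have "y < Sup ?M"
    using assms by (simp only: fuzzy_add_def)
  from this \<open>?M \<noteq> {}\<close> obtain m where m: "m \<in> ?M" "y < m"
    by (rule less_cSupE)
  from m(1) obtain r s where "m = min (v r) (w s)" "r + s = t"
    by (elim CollectE exE conjE)
  with m(2) show ?thesis
    by (intro that[of r s]) simp_all
qed

text \<open>
  The supremum is attained by compactness. For levels \<open>\<beta> n\<close> increasing strictly to \<open>\<alpha>\<close>, the first summands \<open>r\<close> of the
  decompositions of \<open>t\<close> with \<open>v r \<ge> \<beta> n\<close> and \<open>w (t - r) \<ge> \<beta> n\<close> form a decreasing sequence of nonempty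
  compact sets. Positivity of \<open>\<alpha>\<close> matters: superlevel sets are compact only at positive levels.
\<close>

lemma fuzzy_add_ge_iff:
  assumes v: "fuzzy_vector v" and w: "fuzzy_vector w" and \<alpha>: "0 < \<alpha>" "\<alpha> \<le> 1"
  shows "\<alpha> \<le> (v \<oplus>\<^sub>F w) t \<longleftrightarrow> t \<in> level_set v \<alpha> + level_set w \<alpha>"
proof
  assume ge: "\<alpha> \<le> (v \<oplus>\<^sub>F w) t"
  define \<beta> where "\<beta> n = \<alpha> * (1 - 1 / real (n + 2))" for n
  have \<beta>: "0 < \<beta> n" "\<beta> n < \<alpha>" for n
    using \<alpha> by (auto simp: \<beta>_def field_simps intro!: add_pos_nonneg)
  have \<beta>_mono: "\<beta> m \<le> \<beta> n" if "m \<le> n" for m n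
    using that \<alpha> by (simp add: \<beta>_def frac_le)
  have "(\<lambda>n. 1 / real (n + 2)) \<longlonglongrightarrow> 0"
    using LIMSEQ_ignore_initial_segment[OF lim_1_over_n, of 2] by simp
  then have "(\<lambda>n. \<alpha> * (1 - 1 / real (n + 2))) \<longlonglongrightarrow> \<alpha> * (1 - 0)"
    by (intro tendsto_intros)
  then have \<beta>_lim: "\<beta> \<longlonglongrightarrow> \<alpha>"
    unfolding \<beta>_def by simp
  define K where "K n = {r. v r \<ge> \<beta> n} \<inter> (\<lambda>s. t - s) ` {s. w s \<ge> \<beta> n}" for n
  have "\<Inter>(range K) \<noteq> {}"
  proof (rule compact_nest)
    fix n
    have "\<beta> n \<le> 1" using \<beta>(2)[of n] \<alpha> by simp
    then show "compact (K n)"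
      unfolding K_def
      by (intro compact_Int compact_continuous_image continuous_intros compact_superlevel v w \<beta>)
    have "\<beta> n < (v \<oplus>\<^sub>F w) t" using \<beta>(2)[of n] ge by simp
    then obtain r s where "r + s = t" "\<beta> n < v r" "\<beta> n < w s"
      by (rule less_fuzzy_addE)
    then have "r = t - s" "\<beta> n \<le> v r" "\<beta> n \<le> w s" by auto
    then have "r \<in> K n"
      by (simp add: K_def)
    then show "K n \<noteq> {}" by blast
  next
    fix m n :: nat assume "m \<le> n"
    then have "\<beta> m \<le> \<beta> n" by (rule \<beta>_mono)
    then show "K n \<subseteq> K m"
      unfolding K_def by (intro Int_mono image_mono) auto
  qed
  then obtain r where r: "\<And>n. r \<in> K n" by blast
  have "\<beta> n \<le> v r" "\<beta> n \<le> w (t - r)" for n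
    using r[of n] by (auto simp: K_def)
  then have "\<alpha> \<le> v r" "\<alpha> \<le> w (t - r)"
    using LIMSEQ_le_const2[OF \<beta>_lim] by blast+
  then have "r + (t - r) \<in> level_set v \<alpha> + level_set w \<alpha>"
    using \<alpha> by (intro set_plus_intro) (auto simp: level_set_def)
  then show "t \<in> level_set v \<alpha> + level_set w \<alpha>" by simp
next
  assume "t \<in> level_set v \<alpha> + level_set w \<alpha>"
  then obtain r s where "t = r + s" "r \<in> level_set v \<alpha>" "s \<in> level_set w \<alpha>"
    by (rule set_plus_elim)
  then have "\<alpha> \<le> min (v r) (w s)"
    using \<alpha> by (auto simp: level_set_def)
  also have "\<dots> \<le> (v \<oplus>\<^sub>F w) t"
    unfolding \<open>t = r + s\<close> by (rule min_le_fuzzy_add[OF v])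
  finally show "\<alpha> \<le> (v \<oplus>\<^sub>F w) t" .
qed

lemma support_fuzzy_add:
  assumes "fuzzy_vector v"
  shows "{t. (v \<oplus>\<^sub>F w) t > 0} = {t. v t > 0} + {t. w t > 0}"
proof (intro subset_antisym subsetI)
  fix t assume "t \<in> {t. (v \<oplus>\<^sub>F w) t > 0}"
  then have "0 < (v \<oplus>\<^sub>F w) t" by simp
  then obtain r s where "r + s = t" "0 < v r" "0 < w s"
    by (rule less_fuzzy_addE)
  then have "r + s \<in> {t. v t > 0} + {t. w t > 0}"
    by (intro set_plus_intro) simp_all
  then show "t \<in> {t. v t > 0} + {t. w t > 0}"
    by (simp only: \<open>r + s = t\<close>)
next
  fix t assume "t \<in> {t. v t > 0} + {t. w t > 0}"
  then obtain r s where t: "t = r + s" "r \<in> {t. v t > 0}" "s \<in> {t. w t > 0}"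
    by (rule set_plus_elim)
  then have "0 < min (v r) (w s)" by simp
  also have "\<dots> \<le> (v \<oplus>\<^sub>F w) t"
    unfolding \<open>t = r + s\<close> by (rule min_le_fuzzy_add[OF assms])
  finally show "t \<in> {t. (v \<oplus>\<^sub>F w) t > 0}" by simp
qed

lemma level_set_fuzzy_add:
  assumes v: "fuzzy_vector v" and w: "fuzzy_vector w" and \<alpha>: "\<alpha> \<in> {0..1}"
  shows "level_set (v \<oplus>\<^sub>F w) \<alpha> = level_set v \<alpha> + level_set w \<alpha>"
proof (cases "\<alpha> = 0")
  case True
  have "compact (closure {t. v t > 0})" "compact (closure {t. w t > 0})"
    using v w by (auto simp: fuzzy_vector_def)
  then show ?thesis
    using True by (simp add: level_set_def support_fuzzy_add[OF v] closure_set_plus_compact)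
next
  case False
  then have "level_set (v \<oplus>\<^sub>F w) \<alpha> = {t. \<alpha> \<le> (v \<oplus>\<^sub>F w) t}"
    by (simp add: level_set_def)
  also have "\<dots> = level_set v \<alpha> + level_set w \<alpha>"
    using False \<alpha> fuzzy_add_ge_iff[OF v w, of \<alpha>] by simp
  finally show ?thesis .
qed

lemma fuzzy_add_range:
  assumes "fuzzy_vector v" "fuzzy_vector w"
  shows "0 \<le> (v \<oplus>\<^sub>F w) t" "(v \<oplus>\<^sub>F w) t \<le> 1"
proof -
  have "0 \<le> min (v t) (w 0)"
    using fuzzy_vector_range(1)[OF assms(1)] fuzzy_vector_range(1)[OF assms(2)] by simp
  also have "\<dots> \<le> (v \<oplus>\<^sub>F w) (t + 0)"
    by (rule min_le_fuzzy_add[OF assms(1)])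
  finally show "0 \<le> (v \<oplus>\<^sub>F w) t"
    by simp
  show "(v \<oplus>\<^sub>F w) t \<le> 1"
  proof (rule ccontr)
    assume "\<not> ?thesis"
    then have "1 < (v \<oplus>\<^sub>F w) t" by simp
    then obtain r s where "r + s = t" "1 < v r" "1 < w s" by (rule less_fuzzy_addE)
    then show False using fuzzy_vector_range(2)[OF assms(1), of r] by simp
  qed
qed

lemma eq_if_unit_superlevels_eq:
  fixes f g :: "'a \<Rightarrow> real"
  assumes "\<And>t. f t \<in> {0..1}" "\<And>t. g t \<in> {0..1}"
    and iff: "\<And>\<alpha> t. 0 < \<alpha> \<Longrightarrow> \<alpha> \<le> 1 \<Longrightarrow> \<alpha> \<le> f t \<longleftrightarrow> \<alpha> \<le> g t"
  shows "f = g"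
proof
  fix t
  have "0 \<le> f t" "f t \<le> 1" "0 \<le> g t" "g t \<le> 1"
    using assms(1,2)[of t] by auto
  then show "f t = g t"
    using iff[of "f t" t] iff[of "g t" t] by linarith
qed

section \<open>Equivalence of the three descriptions of the sum\<close>

theorem theorem3p1p1:
  fixes u v w :: "real ^ 'n \<Rightarrow> real"
  assumes "fuzzy_vector u" and "fuzzy_vector v" and "fuzzy_vector w"
  shows "(u = v \<oplus>\<^sub>F w \<longleftrightarrow>
            (\<forall>\<alpha>\<in>{0..1}. level_set u \<alpha> = level_set v \<alpha> + level_set w \<alpha>)) \<and>
         ((\<forall>\<alpha>\<in>{0..1}. level_set u \<alpha> = level_set v \<alpha> + level_set w \<alpha>) \<longleftrightarrow>
            (\<forall>\<alpha>\<in>{0..1}. \<forall>x\<in>sphere 0 1.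
               support_fun u \<alpha> x = support_fun v \<alpha> x + support_fun w \<alpha> x))"
proof (intro conjI iffI)
  assume "u = v \<oplus>\<^sub>F w"
  then show "\<forall>\<alpha>\<in>{0..1}. level_set u \<alpha> = level_set v \<alpha> + level_set w \<alpha>"
    using level_set_fuzzy_add assms by blast
next
  assume levels: "\<forall>\<alpha>\<in>{0..1}. level_set u \<alpha> = level_set v \<alpha> + level_set w \<alpha>"
  show "u = v \<oplus>\<^sub>F w"
  proof (rule eq_if_unit_superlevels_eq)
    fix \<alpha> :: real and t assume \<alpha>: "0 < \<alpha>" "\<alpha> \<le> 1"
    have "\<alpha> \<le> u t \<longleftrightarrow> t \<in> level_set u \<alpha>"
      using \<alpha> by (simp add: level_set_def)
    also have "\<dots> \<longleftrightarrow> \<alpha> \<le> (v \<oplus>\<^sub>F w) t"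
      using levels \<alpha> fuzzy_add_ge_iff[OF assms(2,3) \<alpha>] by simp
    finally show "\<alpha> \<le> u t \<longleftrightarrow> \<alpha> \<le> (v \<oplus>\<^sub>F w) t" .
  qed (use fuzzy_vector_range[OF assms(1)] fuzzy_add_range[OF assms(2,3)] in auto)
next
  have level_iff: "level_set u \<alpha> = level_set v \<alpha> + level_set w \<alpha> \<longleftrightarrow>
      (\<forall>x\<in>sphere 0 1. support_fun u \<alpha> x = support_fun v \<alpha> x + support_fun w \<alpha> x)"
    if "\<alpha> \<in> {0..1}" for \<alpha>
    unfolding support_fun_def
    by (intro set_eq_plus_iff_support level_set_compact_convex_nonempty assms that)
  {
    assume "\<forall>\<alpha>\<in>{0..1}. level_set u \<alpha> = level_set v \<alpha> + level_set w \<alpha>"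
    then show "\<forall>\<alpha>\<in>{0..1}. \<forall>x\<in>sphere 0 1.
        support_fun u \<alpha> x = support_fun v \<alpha> x + support_fun w \<alpha> x"
      using level_iff by blast
  next
    assume "\<forall>\<alpha>\<in>{0..1}. \<forall>x\<in>sphere 0 1.
        support_fun u \<alpha> x = support_fun v \<alpha> x + support_fun w \<alpha> x"
    then show "\<forall>\<alpha>\<in>{0..1}. level_set u \<alpha> = level_set v \<alpha> + level_set w \<alpha>"
      using level_iff by blast
  }
qed

end
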